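(* Let $m$ be a positive integer, $S_{2m}$ the symmetric group on $\{1,\dots,2m\}$, and $H$ the centralizer in $S_{2m}$ of $(1\ 2)(3\ 4)\cdots(2m-1\ 2m)$. For any $c>0$, \[\frac{\#\{g\in S_{2m}: |H\cap gHg^{-1}|<m^c\}}{(2m)!}\longrightarrow 0 \quad\text{as } m\to\infty.\] Consequently, the good elements of $S_{2m}$ (those $g$ with $|H\cap gHg^{-1}|=m^{O(1)}$) have density zero.
   Context: Probabilities are with respect to the uniform distribution on $S_{2m}$. *)

theory Defs
  imports Complex_Main "HOL-Library.Landau_Symbols" "HOL-Algebra.Sym_Groups"
begin

definition centralizer :: "('a, 'b) monoid_scheme \<Rightarrow> 'a \<Rightarrow> 'a set" where
  "centralizer G x = {y \<in> carrier G. y \<otimes>\<^bsub>G\<^esub> x = x \<otimes>\<^bsub>G\<^esub> y}"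

definition conj_subset :: "('a, 'b) monoid_scheme \<Rightarrow> 'a \<Rightarrow> 'a set \<Rightarrow> 'a set" where
  "conj_subset G g H = (g <#\<^bsub>G\<^esub> H) #>\<^bsub>G\<^esub> (inv\<^bsub>G\<^esub> g)"

text \<open>The permutation (1 2)(3 4)...(2m-1 2m).\<close>

fun pairing :: "nat \<Rightarrow> nat \<Rightarrow> nat" where
  "pairing 0 = id"
| "pairing (Suc m) = pairing m \<circ> Transposition.transpose (2 * m + 1) (2 * m + 2)"

definition H_sub :: "nat \<Rightarrow> (nat \<Rightarrow> nat) set" where
  "H_sub m = centralizer (sym_group (2 * m)) (pairing m)"

definition inter_order :: "nat \<Rightarrow> (nat \<Rightarrow> nat) \<Rightarrow> nat" where
  "inter_order m g = card (H_sub m \<inter> conj_subset (sym_group (2 * m)) g (H_sub m))"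

text \<open>
  Being good, i.e. having intersection order m to the power O(1), is an asymptotic condition: it
  makes sense for a family of sets of elements, one for each m, with a bound on the exponent that
  is uniform over the elements and over m. As usual with O-notation, the bound is only imposed
  for all sufficiently large m. Every set of the form of all g with intersection order at most
  m to the power C, for a constant C, gives such a family.
\<close>

definition good_family :: "(nat \<Rightarrow> (nat \<Rightarrow> nat) set) \<Rightarrow> bool" where
  "good_family A \<longleftrightarrow>
     (\<forall>m. A m \<subseteq> carrier (sym_group (2 * m))) \<and>
     (\<exists>e :: nat \<Rightarrow> real. e \<in> O(\<lambda>_. 1) \<and>
        (\<forall>\<^sub>F m in sequentially. \<forall>g \<in> A m. real (inter_order m g) \<le> real m powr e m))"

definition density_zero :: "(nat \<Rightarrow> (nat \<Rightarrow> nat) set) \<Rightarrow> bool" where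
  "density_zero A \<longleftrightarrow> (\<lambda>m. real (card (A m)) / fact (2 * m)) \<longlonglongrightarrow> 0"

end

theory Submission
  imports Defs
begin

text \<open>
  The intersection of \<open>H\<close> with its conjugate by \<open>g\<close> is the common centralizer of two fixed-point-free
  involutions \<open>\<sigma>\<close> and \<open>\<tau>\<close>, i.e. of two perfect matchings on \<open>2m\<close> points. A component with \<open>k\<close> edges of
  each matching has \<open>k\<close> rotations commuting with both, so the order \<open>N(\<sigma>, \<tau>)\<close> of this centralizer is at
  least the product of the \<open>k\<close>'s. Summing \<open>N(\<sigma>, \<tau>)\<close> to the power \<open>-s\<close> over all \<open>\<tau>\<close> and splitting off
  the component of one point yields at most \<open>2\<^sup>m m! u\<^sub>m\<close>, where \<open>u\<^sub>0 = 1\<close> and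
  \<open>2m u\<^sub>m\<close> is the sum of \<open>k powr -s * u\<^sub>m\<^sub>-\<^sub>k\<close> over \<open>1 \<le> k \<le> m\<close>. Since the weights tend to \<open>0\<close>, the partial sums
  of \<open>u\<close> grow more slowly than any positive power of \<open>m\<close>, whence \<open>u\<^sub>m = O(m powr (\<delta> - 1))\<close> for every
  \<open>\<delta> > 0\<close>. By Markov's inequality the density of \<open>N < m powr c\<close> is at most
  \<open>(2\<^sup>m m!)\<^sup>2 / (2m)! \<le> 2 sqrt m\<close> times \<open>m powr (c s) * u\<^sub>m\<close>, which tends to \<open>0\<close> once \<open>c s + \<delta> < 1/2\<close>.
\<close>

section \<open>The generating recursion\<close>

text \<open>The value at \<open>n\<close> is the coefficient of \<open>z^n\<close> in the
  exponential of half the sum of \<open>w k * z^k / k\<close> over \<open>k \<ge> 1\<close>. For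
  constant weight \<open>1\<close> this series is \<open>(1 - z)^(-1/2)\<close>, and
  \<open>2^n * n!\<close> times its coefficient is the number of perfect matchings of
  \<open>2 * n\<close> points.\<close>

fun stick_seq :: "(nat \<Rightarrow> real) \<Rightarrow> nat \<Rightarrow> real" where
  "stick_seq w 0 = 1"
| "stick_seq w (Suc n) = (\<Sum>k\<le>n. w (Suc k) * stick_seq w (n - k)) / (2 * real (Suc n))"

lemma stick_seq_nonneg:
  assumes "\<And>k. 0 \<le> w k"
  shows "0 \<le> stick_seq w n"
proof (induction n rule: less_induct)
  case (less n)
  then show ?case
    by (cases n) (auto intro!: sum_nonneg divide_nonneg_nonneg mult_nonneg_nonneg assms)
qed

text \<open>Once the weights are small, the recursion bounds \<open>u (Suc n)\<close> by
  \<open>\<delta> * S n / (n + 1)\<close>, where \<open>S\<close> denotes the partial sums. So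
  \<open>S\<close> grows by a factor of at most \<open>1 + \<delta> / (n + 1)\<close> per step and
  is of order at most \<open>n powr \<delta>\<close>; feeding this back into the bound on
  \<open>u\<close> gains the factor \<open>1 / n\<close>.\<close>

lemma stick_seq_bound:
  assumes w0: "\<And>k. 0 \<le> w k" and w1: "\<And>k. w k \<le> 1" and "w \<longlonglongrightarrow> 0" and d: "0 < \<delta>"
  obtains C where "\<forall>\<^sub>F n in sequentially. stick_seq w n \<le> C * real n powr (\<delta> - 1)"
proof -
  define u where "u = stick_seq w"
  define S where "S n = (\<Sum>j\<le>n. u j)" for n
  have u0: "0 \<le> u n" for n
    unfolding u_def by (rule stick_seq_nonneg[OF w0])
  have S_mono: "S i \<le> S j" if "i \<le> j" for i j
    unfolding S_def using that u0 by (intro sum_mono2) auto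
  have S_pos: "0 < S n" for n
    using S_mono[of 0 n] by (simp add: S_def u_def)
  have rev: "(\<Sum>k\<le>n. u (n - k)) = S n" for n
    unfolding S_def by (rule sum.reindex_bij_witness[of _ "\<lambda>k. n - k" "\<lambda>k. n - k"]) auto
  have u_le: "u (Suc n) \<le> S n / (2 * real (Suc n))" for n
  proof -
    have "(\<Sum>k\<le>n. w (Suc k) * u (n - k)) \<le> (\<Sum>k\<le>n. u (n - k))"
      by (intro sum_mono mult_left_le_one_le u0 w0 w1)
    then show ?thesis
      unfolding rev by (simp add: u_def divide_right_mono)
  qed
  obtain K where K: "\<And>k. k \<ge> K \<Longrightarrow> w k < \<delta>"
    using order_tendstoD(2)[OF \<open>w \<longlonglongrightarrow> 0\<close> d] by (auto simp: eventually_sequentially)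
  \<comment> \<open>This choice ensures \<open>K / (2 * (n - K)) \<le> \<delta>\<close> for all
    \<open>n \<ge> N\<close>.\<close>
  define N where "N = Suc (K + nat \<lceil>K / (2 * \<delta>)\<rceil>)"
  have step: "u (Suc n) \<le> \<delta> * S n / real (Suc n)" if "n \<ge> N" for n
  proof -
    have nK: "real K / (2 * \<delta>) \<le> real (n - K)" "n > K"
      using that unfolding N_def by linarith+
    have small: "u (n - k) \<le> S n / (2 * real (n - K))" if "k < K" for k
    proof -
      obtain i where i: "n - k = Suc i" using nK \<open>k < K\<close> by (cases "n - k") auto
      have "u (n - k) \<le> S i / (2 * real (Suc i))" unfolding i by (rule u_le)
      also have "\<dots> \<le> S n / (2 * real (n - K))"
        using i that nK S_pos[of n] by (intro frac_le S_mono) auto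
      finally show ?thesis .
    qed
    \<comment> \<open>The sum is split at \<open>K\<close>. Late terms have weight below
      \<open>\<delta>\<close>; the first \<open>K\<close> terms have weight at most \<open>1\<close>
      and are controlled by \<open>small\<close>. Each group contributes at most
      \<open>\<delta> * S n\<close>, and the resulting factor \<open>2\<close> cancels against the
      one in the denominator of the recursion.\<close>
    have "w (Suc k) * u (n - k) \<le> \<delta> * u (n - k) + (if k < K then u (n - k) else 0)" for k
    proof (cases "k < K")
      case True
      then show ?thesis
        using mult_right_mono[OF w1[of "Suc k"] u0[of "n - k"]] mult_nonneg_nonneg[OF less_imp_le[OF d] u0[of "n - k"]] by simp
    next
      case False
      then show ?thesis
        using mult_right_mono[OF less_imp_le[OF K[of "Suc k"]] u0[of "n - k"]] by simp
    qed
    then have "(\<Sum>k\<le>n. w (Suc k) * u (n - k))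
        \<le> (\<Sum>k\<le>n. \<delta> * u (n - k) + (if k < K then u (n - k) else 0))"
      by (intro sum_mono)
    also have "\<dots> = \<delta> * S n + (\<Sum>k<K. u (n - k))"
    proof -
      have "{k \<in> {..n}. k < K} = {..<K}" using nK by auto
      then show ?thesis
        by (simp add: sum.distrib sum_distrib_left[symmetric] rev sum.inter_filter[symmetric])
    qed
    also have "(\<Sum>k<K. u (n - k)) \<le> (\<Sum>k<K. S n / (2 * real (n - K)))"
      by (intro sum_mono small) auto
    also have "\<dots> = (real K / (2 * real (n - K))) * S n" by simp
    also have "\<dots> \<le> \<delta> * S n"
      using nK d S_pos[of n] by (intro mult_right_mono) (auto simp: field_simps)
    finally have "(\<Sum>k\<le>n. w (Suc k) * u (n - k)) \<le> 2 * (\<delta> * S n)" by simp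
    then have "(\<Sum>k\<le>n. w (Suc k) * u (n - k)) / (2 * real (Suc n)) \<le> 2 * (\<delta> * S n) / (2 * real (Suc n))"
      by (rule divide_right_mono) simp
    also have "2 * (\<delta> * S n) / (2 * real (Suc n)) = \<delta> * S n / real (Suc n)"
      by (rule mult_divide_mult_cancel_left) simp
    finally show ?thesis by (simp only: u_def stick_seq.simps)
  qed
  define D where "D = S N / real N powr \<delta>"
  have N: "N > 0" by (simp add: N_def)
  have D0: "D \<ge> 0" using S_pos[of N] by (simp add: D_def)
  have growth: "S n \<le> D * real n powr \<delta>" if "n \<ge> N" for n
    using that
  proof (induction n rule: dec_induct)
    case base
    then show ?case using N by (simp add: D_def)
  next
    case (step n)
    have n: "n > 0" using step N by simp
    \<comment> \<open>The bound \<open>D * n powr \<delta>\<close> survives one step because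
      \<open>ln ((n + 1) / n) \<ge> 1 / (n + 1)\<close>.\<close>
    have "1 + \<delta> / real (Suc n) \<le> exp (\<delta> / real (Suc n))" by (rule exp_ge_add_one_self)
    also have "\<dots> \<le> exp (\<delta> * ln (real (Suc n) / real n))"
    proof -
      have "ln (real n / real (Suc n)) \<le> real n / real (Suc n) - 1"
        using n by (intro ln_le_minus_one) auto
      also have "\<dots> = - (1 / real (Suc n))" by (simp add: field_simps)
      finally have "1 / real (Suc n) \<le> ln (real (Suc n) / real n)"
        using n by (simp add: ln_div)
      then have "\<delta> * (1 / real (Suc n)) \<le> \<delta> * ln (real (Suc n) / real n)"
        using d by (intro mult_left_mono) auto
      then show ?thesis by simp
    qed
    also have "\<dots> = (real (Suc n) / real n) powr \<delta>" using n by (simp add: powr_def)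
    finally have fac: "1 + \<delta> / real (Suc n) \<le> (real (Suc n) / real n) powr \<delta>" .
    have "S (Suc n) = S n + u (Suc n)" by (simp add: S_def)
    also have "\<dots> \<le> S n * (1 + \<delta> / real (Suc n))"
      using \<open>N \<le> n\<close> \<open>\<And>n. n \<ge> N \<Longrightarrow> u (Suc n) \<le> \<delta> * S n / real (Suc n)\<close>[of n] by (simp add: algebra_simps)
    also have "\<dots> \<le> (D * real n powr \<delta>) * (real (Suc n) / real n) powr \<delta>"
      using step.IH fac S_pos[of n] d D0 by (intro mult_mono) auto
    also have "\<dots> = D * real (Suc n) powr \<delta>"
      using n by (simp add: powr_divide)
    finally show ?case .
  qed
  have "stick_seq w n \<le> (\<delta> * D) * real n powr (\<delta> - 1)" if "n > N" for n
  proof -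
    obtain i where i: "n = Suc i" "i \<ge> N" using \<open>n > N\<close> by (cases n) auto
    have "u n \<le> \<delta> * S i / real n" using step i by simp
    also have "\<dots> \<le> \<delta> * (D * real n powr \<delta>) / real n"
    proof -
      have "S i \<le> S n" using i by (intro S_mono) auto
      also have "\<dots> \<le> D * real n powr \<delta>" using that by (intro growth) auto
      finally show ?thesis using d by (intro divide_right_mono mult_left_mono) auto
    qed
    also have "\<dots> = (\<delta> * D) * real n powr (\<delta> - 1)"
      using that by (simp add: powr_diff)
    finally show ?thesis by (simp add: u_def)
  qed
  then have "\<forall>\<^sub>F n in sequentially. stick_seq w n \<le> (\<delta> * D) * real n powr (\<delta> - 1)"
    unfolding eventually_at_top_dense by blast
  then show ?thesis by (rule that)
qed

text \<open>This is a lower bound for the central binomial coefficient, which is \<open>4^m\<close>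
  divided by the quotient of the two factorial terms. The induction step comes down to
  \<open>4 * m * (m + 1) \<le> (2 * m + 1)^2\<close>.\<close>

lemma fact_double_le: "(2 ^ m * fact m) ^ 2 \<le> 2 * sqrt (real m) * fact (2 * m)" if "m > 0"
  using that
proof (induction m rule: nat_induct_non_zero)
  case 1
  then show ?case by (simp add: fact_numeral)
next
  case (Suc m)
  have "(2 ^ Suc m * fact (Suc m)) ^ 2 = (2 ^ m * fact m) ^ 2 * (2 * (real m + 1)) ^ 2"
    by (simp add: power2_eq_square algebra_simps)
  also have "\<dots> \<le> (2 * sqrt (real m) * fact (2 * m)) * (2 * (real m + 1)) ^ 2"
    by (intro mult_right_mono Suc.IH) auto
  also have "\<dots> \<le> (2 * fact (2 * m)) * (sqrt (real m + 1) * ((2 * real m + 1) * (2 * real m + 2)))"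
  proof -
    have "sqrt (real m) * (2 * (real m + 1)) = sqrt (real m * (2 * (real m + 1))\<^sup>2)"
      by (simp add: real_sqrt_mult)
    also have "\<dots> \<le> sqrt ((real m + 1) * (2 * real m + 1)\<^sup>2)"
      by (rule real_sqrt_le_mono) (simp add: power2_eq_square algebra_simps)
    also have "\<dots> = sqrt (real m + 1) * (2 * real m + 1)"
      by (simp add: real_sqrt_mult)
    finally have "sqrt (real m) * (2 * (real m + 1)) * (2 * real m + 2) \<le> sqrt (real m + 1) * (2 * real m + 1) * (2 * real m + 2)"
      by (rule mult_right_mono) simp
    then have "sqrt (real m) * (2 * (real m + 1))^2 \<le> sqrt (real m + 1) * ((2 * real m + 1) * (2 * real m + 2))"
      by (simp add: power2_eq_square algebra_simps)
    then have "(2 * fact (2 * m)) * (sqrt (real m) * (2 * (real m + 1))^2) \<le> (2 * fact (2 * m)) * (sqrt (real m + 1) * ((2 * real m + 1) * (2 * real m + 2)))"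
      by (rule mult_left_mono) simp
    then show ?thesis by (simp only: mult_ac)
  qed
  also have "\<dots> = 2 * sqrt (real (Suc m)) * fact (2 * Suc m)"
    by (simp add: algebra_simps)
  finally show ?case .
qed

section \<open>Pairs of matchings\<close>

text \<open>Nothing is imposed off \<open>A\<close>, so one and the same \<open>\<sigma>\<close>
  serves for all the smaller sets left after components are removed.\<close>

definition fpf_invol_on :: "('a \<Rightarrow> 'a) \<Rightarrow> 'a set \<Rightarrow> bool" where
  "fpf_invol_on \<sigma> A \<longleftrightarrow> (\<forall>x\<in>A. \<sigma> x \<in> A \<and> \<sigma> x \<noteq> x \<and> \<sigma> (\<sigma> x) = x)"

text \<open>Elements are the identity off \<open>A\<close>, so each perfect matching is represented
  by exactly one function.\<close>

definition matchings :: "'a set \<Rightarrow> ('a \<Rightarrow> 'a) set" where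
  "matchings A = {\<tau>. \<tau> permutes A \<and> fpf_invol_on \<tau> A}"

definition commuting :: "'a set \<Rightarrow> ('a \<Rightarrow> 'a) \<Rightarrow> ('a \<Rightarrow> 'a) \<Rightarrow> ('a \<Rightarrow> 'a) set" where
  "commuting A \<sigma> \<tau> = {p. p permutes A \<and> (\<forall>x\<in>A. p (\<sigma> x) = \<sigma> (p x) \<and> p (\<tau> x) = \<tau> (p x))}"

text \<open>Such a list selects \<open>n\<close> different edges of \<open>\<sigma>\<close> in a
  certain order, together with one endpoint of each. Alternating walks through a component are
  recorded in this form.\<close>

definition edge_lists :: "('a \<Rightarrow> 'a) \<Rightarrow> 'a set \<Rightarrow> nat \<Rightarrow> 'a list set" where
  "edge_lists \<sigma> A n =
     {xs. length xs = n \<and> set xs \<subseteq> A \<and> sorted_wrt (\<lambda>x y. y \<noteq> x \<and> y \<noteq> \<sigma> x) xs}"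

definition covered :: "('a \<Rightarrow> 'a) \<Rightarrow> 'a list \<Rightarrow> 'a set" where
  "covered \<sigma> xs = set xs \<union> \<sigma> ` set xs"

lemma fpf_invol_onD:
  assumes "fpf_invol_on \<sigma> A" "x \<in> A"
  shows "\<sigma> x \<in> A" "\<sigma> x \<noteq> x" "\<sigma> (\<sigma> x) = x"
  using assms by (auto simp: fpf_invol_on_def)

lemma fpf_invol_on_Diff:
  assumes "fpf_invol_on \<sigma> A" "\<And>x. x \<in> C \<Longrightarrow> \<sigma> x \<in> C"
  shows "fpf_invol_on \<sigma> (A - C)"
  using assms unfolding fpf_invol_on_def by (metis Diff_iff)

lemma finite_matchings: "finite A \<Longrightarrow> finite (matchings A)"
  by (rule finite_subset[OF _ finite_permutations[of A]]) (auto simp: matchings_def)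

lemma finite_commuting: "finite A \<Longrightarrow> finite (commuting A \<sigma> \<tau>)"
  by (rule finite_subset[OF _ finite_permutations[of A]]) (auto simp: commuting_def)

lemma card_commuting_pos: "finite A \<Longrightarrow> card (commuting A \<sigma> \<tau>) > 0"
  using finite_commuting[of A \<sigma> \<tau>]
  by (auto simp: card_gt_0_iff set_eq_iff commuting_def intro!: exI[of _ id] permutes_id)

lemma commuting_comp:
  assumes "p \<in> commuting A \<sigma> \<tau>" "q \<in> commuting A \<sigma> \<tau>"
  shows "p \<circ> q \<in> commuting A \<sigma> \<tau>"
  using assms by (auto simp: commuting_def permutes_compose permutes_in_image)

lemma commuting_funpow: "p \<in> commuting A \<sigma> \<tau> \<Longrightarrow> p ^^ n \<in> commuting A \<sigma> \<tau>"
proof (induction n)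
  case 0
  then show ?case using permutes_id[of A] by (simp add: commuting_def id_def)
next
  case (Suc n)
  then show ?case using commuting_comp[of p A \<sigma> \<tau> "p ^^ n"] by (simp add: comp_def)
qed

text \<open>A permutation of \<open>A - C\<close> fixes \<open>C\<close> pointwise, so on the closed
  set \<open>C\<close> it commutes with both maps trivially.\<close>

lemma commuting_Diff_subset:
  assumes "\<And>x. x \<in> C \<Longrightarrow> \<sigma> x \<in> C" "\<And>x. x \<in> C \<Longrightarrow> \<tau> x \<in> C"
  shows "commuting (A - C) \<sigma> \<tau> \<subseteq> commuting A \<sigma> \<tau>"
proof
  fix p assume p: "p \<in> commuting (A - C) \<sigma> \<tau>"
  then have perm: "p permutes (A - C)" by (simp add: commuting_def)
  have fix_C: "p z = z" if "z \<in> C" for z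
    using permutes_not_in[OF perm] that by auto
  have "p (\<sigma> z) = \<sigma> (p z) \<and> p (\<tau> z) = \<tau> (p z)" if "z \<in> A" for z
    using p that assms fix_C by (cases "z \<in> C") (auto simp: commuting_def)
  then show "p \<in> commuting A \<sigma> \<tau>"
    using permutes_subset[OF perm] by (auto simp: commuting_def)
qed

section \<open>Counting lists of edges of a matching\<close>

lemma edge_lists_0 [simp]: "edge_lists \<sigma> A 0 = {[]}"
  by (auto simp: edge_lists_def)

lemma Cons_in_edge_lists:
  "x # xs \<in> edge_lists \<sigma> A (Suc n) \<longleftrightarrow> x \<in> A \<and> xs \<in> edge_lists \<sigma> (A - {x, \<sigma> x}) n"
  by (auto simp: edge_lists_def)

lemma edge_lists_Suc:
  "edge_lists \<sigma> A (Suc n) = (\<Union>x\<in>A. Cons x ` edge_lists \<sigma> (A - {x, \<sigma> x}) n)"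
proof -
  have "xs \<in> edge_lists \<sigma> A (Suc n) \<longleftrightarrow> xs \<in> (\<Union>x\<in>A. Cons x ` edge_lists \<sigma> (A - {x, \<sigma> x}) n)" for xs
    by (cases xs) (auto simp: Cons_in_edge_lists, auto simp: edge_lists_def)
  then show ?thesis by blast
qed

lemma finite_edge_lists: "finite A \<Longrightarrow> finite (edge_lists \<sigma> A n)"
  by (rule finite_subset[OF _ finite_lists_length_eq[of A n]]) (auto simp: edge_lists_def)

lemma fpf_invol_on_Diff_edge:
  assumes "fpf_invol_on \<sigma> A" "x \<in> A"
  shows "fpf_invol_on \<sigma> (A - {x, \<sigma> x})"
  using fpf_invol_onD[OF assms] by (intro fpf_invol_on_Diff assms) auto

lemma card_Diff_edge:
  assumes "fpf_invol_on \<sigma> A" "x \<in> A" "finite A"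
  shows "card (A - {x, \<sigma> x}) = card A - 2"
  using fpf_invol_onD[OF assms(1,2)] assms by (subst card_Diff_subset) auto

text \<open>The head is any of the \<open>2 * a\<close> points, and removing its edge leaves
  \<open>a - 1\<close> edges for the tail. The factorial on the left avoids a quotient.\<close>

lemma card_edge_lists:
  assumes "finite A" "fpf_invol_on \<sigma> A" "card A = 2 * a" "n \<le> a"
  shows "card (edge_lists \<sigma> A n) * fact (a - n) = 2 ^ n * fact a"
  using assms
proof (induction n arbitrary: A a)
  case 0
  then show ?case by simp
next
  case (Suc n)
  then obtain b where b: "a = Suc b" "n \<le> b" by (cases a) auto
  have IH: "card (edge_lists \<sigma> (A - {x, \<sigma> x}) n) * fact (b - n) = 2 ^ n * fact b" if "x \<in> A" for x
    using Suc.prems that b by (intro Suc.IH) (auto simp: fpf_invol_on_Diff_edge card_Diff_edge)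
  have "card (edge_lists \<sigma> A (Suc n)) = (\<Sum>x\<in>A. card (edge_lists \<sigma> (A - {x, \<sigma> x}) n))"
    unfolding edge_lists_Suc using Suc.prems
    by (subst card_UN_disjoint) (auto intro!: finite_imageI finite_edge_lists sum.cong card_image)
  then have "card (edge_lists \<sigma> A (Suc n)) * fact (a - Suc n)
      = (\<Sum>x\<in>A. card (edge_lists \<sigma> (A - {x, \<sigma> x}) n) * fact (b - n))"
    by (simp add: b sum_distrib_right)
  also have "\<dots> = 2 ^ Suc n * fact a"
    using Suc.prems by (subst sum.cong[OF refl IH]) (simp_all add: b algebra_simps)
  finally show ?case .
qed

lemma covered_subset:
  assumes "fpf_invol_on \<sigma> A" "xs \<in> edge_lists \<sigma> A n"
  shows "covered \<sigma> xs \<subseteq> A"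
  using assms by (auto simp: covered_def edge_lists_def fpf_invol_on_def)

lemma covered_closed:
  assumes "fpf_invol_on \<sigma> A" "xs \<in> edge_lists \<sigma> A n" "x \<in> covered \<sigma> xs"
  shows "\<sigma> x \<in> covered \<sigma> xs"
  using assms by (auto simp: covered_def edge_lists_def fpf_invol_on_def subset_iff)

lemma card_covered:
  assumes "finite A" "fpf_invol_on \<sigma> A" "xs \<in> edge_lists \<sigma> A n"
  shows "card (covered \<sigma> xs) = 2 * n"
  using assms
proof (induction n arbitrary: A xs)
  case 0
  then show ?case by (simp add: covered_def)
next
  case (Suc n)
  then obtain x ys where xs: "xs = x # ys" "x \<in> A" "ys \<in> edge_lists \<sigma> (A - {x, \<sigma> x}) n"
    unfolding edge_lists_Suc by auto
  have inv: "fpf_invol_on \<sigma> (A - {x, \<sigma> x})" using Suc.prems xs fpf_invol_on_Diff_edge by metis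
  have "card (covered \<sigma> ys) = 2 * n" using Suc.prems inv xs by (intro Suc.IH) auto
  moreover have "covered \<sigma> xs = {x, \<sigma> x} \<union> covered \<sigma> ys" by (auto simp: covered_def xs)
  moreover have "covered \<sigma> ys \<subseteq> A - {x, \<sigma> x}" using covered_subset[OF inv xs(3)] .
  moreover have "card {x, \<sigma> x} = 2" using fpf_invol_onD[OF Suc.prems(2) xs(2)] by simp
  ultimately show ?case
    using card_Un_disjoint[of "{x, \<sigma> x}" "covered \<sigma> ys"] finite_subset[of "covered \<sigma> ys" A] Suc.prems(1)
    by auto
qed

section \<open>The component of a point in the union of two matchings\<close>

locale two_matchings =
  fixes A :: "'a set" and \<sigma> \<tau> :: "'a \<Rightarrow> 'a" and x :: 'a
  assumes fin: "finite A" and \<sigma>: "fpf_invol_on \<sigma> A" and \<tau>: "fpf_invol_on \<tau> A" and x: "x \<in> A"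
begin

text \<open>One step along each matching. Being the identity off \<open>A\<close> makes it a
  permutation of \<open>A\<close>, so that the walk from \<open>x\<close> is periodic.\<close>

definition r where "r z = (if z \<in> A then \<tau> (\<sigma> z) else z)"

text \<open>The number of edges of \<open>\<sigma>\<close> in the component of \<open>x\<close>,
  which is half the number of its points.\<close>

definition k where "k = least_power r x"

definition y where "y i = (r ^^ i) x"

lemmas \<sigma>D = fpf_invol_onD[OF \<sigma>]
lemmas \<tau>D = fpf_invol_onD[OF \<tau>]

lemma r_permutes: "r permutes A"
proof -
  have "inj_on r A"
    by (rule inj_onI) (metis r_def \<sigma>D(1,3) \<tau>D(3))
  moreover have "r ` A \<subseteq> A" using \<sigma>D \<tau>D by (auto simp: r_def)
  ultimately have "bij_betw r A A" using fin by (auto simp: bij_betw_def endo_inj_surj)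
  then show ?thesis by (rule bij_imp_permutes) (simp add: r_def)
qed

lemma r_inj: "r u = r v \<longleftrightarrow> u = v"
  using permutes_inj[OF r_permutes] by (auto dest: injD)

lemma y_in: "y i \<in> A"
  by (induction i) (auto simp: y_def x permutes_in_image[OF r_permutes])

lemma y_0: "y 0 = x"
  by (simp add: y_def)

lemma r_y: "r (y i) = y (Suc i)"
  by (simp add: y_def)

lemma y_Suc: "y (Suc i) = \<tau> (\<sigma> (y i))"
  using r_y[of i] y_in[of i] by (simp add: r_def)

lemma \<tau>_y_Suc: "\<tau> (y (Suc i)) = \<sigma> (y i)"
  by (simp add: y_Suc \<tau>D \<sigma>D y_in)

lemma k_pos: "0 < k" and y_k: "y k = x"
proof -
  have "permutation r" using r_permutes fin permutation_permutes by blast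
  from least_power_of_permutation[OF this] show "0 < k" "y k = x"
    by (auto simp: k_def y_def)
qed

lemma y_mod: "y (i mod k) = y i"
  using funpow_mod_eq[of k r x i] y_k by (simp add: y_def)

lemma y_inj: "inj_on y {..<k}"
proof (rule inj_onI)
  have *: "y i \<noteq> y j" if "i < j" "j < k" for i j
  proof
    assume "y i = y j"
    moreover have "(r ^^ j) x = (r ^^ i) ((r ^^ (j - i)) x)"
      using that fun_cong[OF funpow_add[of i "j - i" r], of x] by simp
    ultimately have "(r ^^ i) x = (r ^^ i) ((r ^^ (j - i)) x)"
      by (simp add: y_def)
    moreover have "inj (r ^^ i)" using permutes_inj[OF r_permutes] by (rule inj_fn)
    ultimately have "x = (r ^^ (j - i)) x" by (rule injD[rotated])
    then have "k \<le> j - i"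
      unfolding k_def using that by (intro least_power_le[OF sym]) simp_all
    then show False using that by simp
  qed
  fix i j assume "i \<in> {..<k}" "j \<in> {..<k}" "y i = y j"
  then show "i = j" using *[of i j] *[of j i] by (cases i j rule: linorder_cases) auto
qed

text \<open>Moving both indices towards each other ends at a fixed point of one of the involutions.\<close>

lemma \<sigma>_y_neq: "\<sigma> (y i) \<noteq> y j"
proof -
  have "\<sigma> (y i) \<noteq> y (i + d)" for i d
  proof (induction d arbitrary: i rule: less_induct)
    case (less d)
    consider "d = 0" | "d = 1" | e where "d = Suc (Suc e)"
      by (metis One_nat_def not0_implies_Suc)
    then show ?case
    proof cases
      case 1
      then show ?thesis using \<sigma>D(2) y_in by simp
    next
      case 2
      then show ?thesis using y_Suc[of i] \<tau>D(2)[of "\<sigma> (y i)"] \<sigma>D(1) y_in by auto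
    next
      case 3
      show ?thesis
      proof
        assume eq: "\<sigma> (y i) = y (i + d)"
        then have "y (Suc i) = \<tau> (y (Suc (i + Suc e)))" by (simp add: y_Suc 3)
        also have "\<dots> = \<sigma> (y (Suc i + e))" by (simp add: \<tau>_y_Suc)
        finally have "\<sigma> (y (Suc i)) = y (Suc i + e)" by (simp add: \<sigma>D y_in)
        then show False using less.IH[of e "Suc i"] 3 by simp
      qed
    qed
  qed
  from this[of i "j - i"] this[of j "i - j"] show ?thesis
    using \<sigma>D(3)[OF y_in, of i] by (cases "i \<le> j") auto
qed

text \<open>The component of \<open>x\<close>: the cycle of \<open>r\<close> through
  \<open>x\<close> and its mirror image under \<open>\<sigma>\<close>.\<close>

definition C where "C = range y \<union> \<sigma> ` range y"

text \<open>The walk closes up after \<open>k\<close> steps, so even \<open>y 0\<close> has a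
  predecessor. This gives access to \<open>\<tau> (y i)\<close>, which is \<open>\<sigma>\<close> of
  the predecessor of \<open>y i\<close>.\<close>

lemma y_pred: obtains j where "y i = y (Suc j)"
proof (cases i)
  case 0
  then show ?thesis using that[of "k - 1"] k_pos y_k y_0 by simp
next
  case (Suc j)
  then show ?thesis using that by simp
qed

lemma C_cases:
  assumes "z \<in> C"
  obtains i where "z = y i" | i where "z = \<sigma> (y i)"
  using assms by (auto simp: C_def)

lemma C_subset: "C \<subseteq> A"
  using \<sigma>D y_in by (auto simp: C_def)

lemma \<sigma>_C: "z \<in> C \<Longrightarrow> \<sigma> z \<in> C"
  by (auto simp: C_def \<sigma>D(3) y_in)

lemma \<tau>_C: "z \<in> C \<Longrightarrow> \<tau> z \<in> C"
proof (erule C_cases)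
  fix i assume "z = y i"
  then show ?thesis using y_pred[of i] \<tau>_y_Suc by (metis C_def UnI2 imageI rangeI)
next
  fix i assume "z = \<sigma> (y i)"
  then show ?thesis using y_Suc[of i] by (metis C_def UnI1 rangeI)
qed

text \<open>The start \<open>x\<close> is dropped because it is fixed in advance; what remains has
  length \<open>k - 1\<close> and selects edges of \<open>\<sigma>\<close> outside
  \<open>{x, \<sigma> x}\<close>.\<close>

definition tail where "tail = map y [1..<k]"

lemma x_tail: "x # tail = map y [0..<k]"
  using k_pos by (simp add: tail_def upt_rec[of 0 k] y_0)

lemma edge_list: "x # tail \<in> edge_lists \<sigma> A k"
proof -
  have "y j \<noteq> y i \<and> y j \<noteq> \<sigma> (y i)" if "i < j" "j < k" for i j
    using inj_onD[OF y_inj, of i j] that \<sigma>_y_neq[of i j] by auto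
  then show ?thesis
    unfolding x_tail using y_in by (auto simp: edge_lists_def sorted_wrt_iff_nth_less)
qed

lemma range_y: "range y = set (x # tail)"
proof -
  have "y i \<in> y ` {0..<k}" for i
    using y_mod[of i] k_pos by (metis atLeastLessThan_iff imageI mod_less_divisor zero_le)
  then show ?thesis unfolding x_tail by auto
qed

lemma covered_eq: "covered \<sigma> (x # tail) = C"
  unfolding covered_def C_def range_y ..

text \<open>
  The rotation of the component by two steps: \<open>r\<close> on one half of its points and the inverse of \<open>r\<close>,
  which is \<open>\<sigma> \<circ> r \<circ> \<sigma>\<close>, on the other half. The map \<open>r\<close> itself does not commute with \<open>\<sigma>\<close>.
\<close>

definition \<rho> where
  "\<rho> z = (if z \<in> range y then r z else if z \<in> \<sigma> ` range y then \<sigma> (r (\<sigma> z)) else z)"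

lemma \<rho>_y: "\<rho> (y i) = y (Suc i)"
  by (simp add: \<rho>_def r_y)

lemma \<rho>_\<sigma>_y: "\<rho> (\<sigma> (y i)) = \<sigma> (y (Suc i))"
  using \<sigma>_y_neq by (auto simp: \<rho>_def r_y \<sigma>D(3) y_in)

lemma \<rho>_outside: "z \<notin> C \<Longrightarrow> \<rho> z = z"
  by (auto simp: \<rho>_def C_def)

lemma \<rho>_C: "z \<in> C \<Longrightarrow> \<rho> z \<in> C"
  by (erule C_cases) (auto simp: \<rho>_y \<rho>_\<sigma>_y C_def)

lemma y_Suc_cancel: "y (Suc i) = y (Suc j) \<longleftrightarrow> y i = y j"
  by (metis r_y r_inj)

lemma \<sigma>_y_cancel: "\<sigma> (y i) = \<sigma> (y j) \<longleftrightarrow> y i = y j"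
  by (metis \<sigma>D(3) y_in)

lemma \<rho>_permutes: "\<rho> permutes A"
proof -
  have "inj_on \<rho> C"
  proof (rule inj_onI)
    fix u v assume "u \<in> C" "v \<in> C" "\<rho> u = \<rho> v"
    then show "u = v"
      by (elim C_cases)
        (use \<sigma>_y_neq in \<open>auto simp: \<rho>_y \<rho>_\<sigma>_y y_Suc_cancel \<sigma>_y_cancel dest: sym\<close>)
  qed
  moreover have "\<rho> ` C \<subseteq> C" using \<rho>_C by auto
  moreover have "finite C" using C_subset fin by (rule finite_subset)
  ultimately have "bij_betw \<rho> C C" by (auto simp: bij_betw_def endo_inj_surj)
  then have "\<rho> permutes C" by (rule bij_imp_permutes) (rule \<rho>_outside)
  then show ?thesis using C_subset by (rule permutes_subset)
qed

lemma \<rho>_commuting: "\<rho> \<in> commuting A \<sigma> \<tau>"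
proof -
  have "\<rho> (\<sigma> z) = \<sigma> (\<rho> z) \<and> \<rho> (\<tau> z) = \<tau> (\<rho> z)" if "z \<in> C" for z
    using that
  proof (rule C_cases)
    fix i assume z: "z = y i"
    obtain j where j: "y i = y (Suc j)" by (rule y_pred)
    then have "y (Suc i) = y (Suc (Suc j))" by (simp add: y_Suc_cancel)
    then show ?thesis using j by (simp add: z \<rho>_y \<rho>_\<sigma>_y \<tau>_y_Suc)
  next
    fix i assume z: "z = \<sigma> (y i)"
    have "\<tau> (\<sigma> (y j)) = y (Suc j)" for j by (simp add: y_Suc)
    then show ?thesis by (simp add: z \<rho>_y \<rho>_\<sigma>_y \<sigma>D(3) y_in)
  qed
  moreover have "\<sigma> z \<notin> C" "\<tau> z \<notin> C" if "z \<in> A" "z \<notin> C" for z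
    using that \<sigma>_C[of "\<sigma> z"] \<tau>_C[of "\<tau> z"] \<sigma>D(3) \<tau>D(3) by metis+
  ultimately have "\<rho> (\<sigma> z) = \<sigma> (\<rho> z) \<and> \<rho> (\<tau> z) = \<tau> (\<rho> z)" if "z \<in> A" for z
    using that \<rho>_outside by (cases "z \<in> C") simp_all
  then show ?thesis
    using \<rho>_permutes by (simp add: commuting_def)
qed

lemma \<rho>_funpow_x: "(\<rho> ^^ i) x = y i"
  by (induction i) (simp_all add: y_0 \<rho>_y)

text \<open>The maps \<open>(\<rho> ^^ j) \<circ> q\<close> with \<open>j < k\<close> and
  \<open>q\<close> commuting on the rest all commute with both matchings. They are distinct: the
  image of \<open>x\<close> is \<open>y j\<close>, which reveals \<open>j\<close>, and then
  \<open>q\<close> is found by cancelling \<open>\<rho> ^^ j\<close>.\<close>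

lemma card_commuting_ge: "k * card (commuting (A - C) \<sigma> \<tau>) \<le> card (commuting A \<sigma> \<tau>)"
proof -
  have sub: "commuting (A - C) \<sigma> \<tau> \<subseteq> commuting A \<sigma> \<tau>"
    by (rule commuting_Diff_subset) (erule \<sigma>_C \<tau>_C)+
  define f where "f = (\<lambda>(j, q :: 'a \<Rightarrow> 'a). (\<rho> ^^ j) \<circ> q)"
  have "y 0 \<in> C" by (simp add: C_def)
  then have "x \<in> C" by (simp only: y_0)
  then have q_x: "q x = x" if "q \<in> commuting (A - C) \<sigma> \<tau>" for q
    using that permutes_not_in[of q "A - C" x] by (auto simp: commuting_def)
  have "inj_on f ({..<k} \<times> commuting (A - C) \<sigma> \<tau>)"
  proof (rule inj_onI, clarify)
    fix i p j q
    assume ij: "i < k" "j < k" and p: "p \<in> commuting (A - C) \<sigma> \<tau>" and q: "q \<in> commuting (A - C) \<sigma> \<tau>"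
      and eq: "f (i, p) = f (j, q)"
    have "y i = y j" using fun_cong[OF eq, of x] p q by (simp add: f_def q_x \<rho>_funpow_x)
    then have "i = j" using ij inj_onD[OF y_inj] by simp
    moreover have "inj (\<rho> ^^ j)" using permutes_inj[OF \<rho>_permutes] by (rule inj_fn)
    ultimately show "i = j \<and> p = q" using eq by (auto simp: f_def fun_eq_iff dest: injD)
  qed
  moreover have "f ` ({..<k} \<times> commuting (A - C) \<sigma> \<tau>) \<subseteq> commuting A \<sigma> \<tau>"
    using sub
    by (auto simp: f_def intro!: commuting_comp commuting_funpow \<rho>_commuting)
  ultimately have "card ({..<k} \<times> commuting (A - C) \<sigma> \<tau>) \<le> card (commuting A \<sigma> \<tau>)"
    using finite_commuting[OF fin] by (rule card_inj_on_le)
  then show ?thesis by (simp add: card_cartesian_product)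
qed

text \<open>The matching induced by \<open>\<tau>\<close> outside the component, replaced by the
  identity elsewhere so that it is an element of \<open>matchings (A - C)\<close>.\<close>

definition rest where "rest z = (if z \<in> A - C then \<tau> z else z)"

lemma \<tau>_rest: "z \<in> A - C \<Longrightarrow> \<tau> z \<in> A - C"
  using \<tau>_C[of "\<tau> z"] \<tau>D by auto

lemma rest_matching: "rest \<in> matchings (A - C)"
proof -
  have inv: "fpf_invol_on rest (A - C)"
    using \<tau>_rest \<tau>D by (auto simp: fpf_invol_on_def rest_def)
  have "bij_betw rest (A - C) (A - C)"
    by (rule bij_betwI[of _ _ _ rest]) (use fpf_invol_onD[OF inv] in auto)
  then have "rest permutes (A - C)" by (rule bij_imp_permutes) (auto simp: rest_def)
  with inv show ?thesis by (simp add: matchings_def)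
qed

lemma commuting_rest: "commuting (A - C) \<sigma> rest = commuting (A - C) \<sigma> \<tau>"
proof -
  have "p (rest z) = rest (p z) \<longleftrightarrow> p (\<tau> z) = \<tau> (p z)" if "p permutes (A - C)" "z \<in> A - C" for p z
    using that permutes_in_image[OF that(1), of z] by (simp add: rest_def)
  then show ?thesis unfolding commuting_def by blast
qed

text \<open>Both \<open>\<tau>\<close> and \<open>\<tau>'\<close> send \<open>\<sigma> (y i)\<close> to \<open>y (i + 1)\<close>, so the list of the \<open>y i\<close> determines them on \<open>C\<close>.\<close>

lemma determined:
  assumes "two_matchings A \<sigma> \<tau>' x" "\<tau> permutes A" "\<tau>' permutes A"
    and tail: "two_matchings.tail A \<sigma> \<tau>' x = tail"
    and rest: "two_matchings.rest A \<sigma> \<tau>' x = rest"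
  shows "\<tau>' = \<tau>"
proof -
  interpret T: two_matchings A \<sigma> \<tau>' x by fact
  \<comment> \<open>The recorded list determines \<open>k\<close> by its length and the walk over
    one period, hence the whole walk.\<close>
  have xt: "map T.y [0..<T.k] = map y [0..<k]"
    using x_tail T.x_tail tail by simp
  then have kk: "T.k = k" by (metis length_map length_upt diff_zero)
  have yy_lt: "T.y i = y i" if "i < k" for i
    using arg_cong[OF xt, of "\<lambda>l. l ! i"] that kk by simp
  have yy: "T.y i = y i" for i
    using yy_lt[of "i mod k"] y_mod[of i] T.y_mod[of i] k_pos by (simp add: kk)
  have CC: "T.C = C" by (simp add: covered_eq[symmetric] T.covered_eq[symmetric] tail)
  have "\<tau>' z = \<tau> z" for z
  proof -
    consider "z \<notin> A" | "z \<in> A - C" | "z \<in> C" by auto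
    then show ?thesis
    proof cases
      case 1
      then show ?thesis using permutes_not_in assms(2,3) by metis
    next
      case 2
      then show ?thesis using fun_cong[OF rest, of z] by (simp add: T.rest_def rest_def CC)
    next
      case 3
      then show ?thesis
      proof (rule C_cases)
        fix i assume z: "z = y i"
        obtain j where "y i = y (Suc j)" by (rule y_pred)
        then show ?thesis using \<tau>_y_Suc[of j] T.\<tau>_y_Suc[of j] by (simp add: z yy)
      next
        fix i assume "z = \<sigma> (y i)"
        then show ?thesis using y_Suc[of i] T.y_Suc[of i] by (simp add: yy)
      qed
    qed
  qed
  then show ?thesis by auto
qed

end

section \<open>Averaging over matchings\<close>

definition commuting_sum :: "real \<Rightarrow> 'a set \<Rightarrow> ('a \<Rightarrow> 'a) \<Rightarrow> real" where
  "commuting_sum s A \<sigma> = (\<Sum>\<tau>\<in>matchings A. real (card (commuting A \<sigma> \<tau>)) powr - s)"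

text \<open>The negative exponent reverses \<open>card_commuting_ge\<close>; the smaller side is
  positive because the identity always commutes.\<close>

lemma (in two_matchings) commuting_powr_le:
  assumes "0 \<le> s"
  shows "real (card (commuting A \<sigma> \<tau>)) powr - s
    \<le> real k powr - s * real (card (commuting (A - C) \<sigma> rest)) powr - s"
proof -
  have "real (k * card (commuting (A - C) \<sigma> rest)) \<le> real (card (commuting A \<sigma> \<tau>))"
    unfolding commuting_rest using card_commuting_ge by (rule of_nat_mono)
  moreover have "0 < real (k * card (commuting (A - C) \<sigma> rest))"
    using k_pos card_commuting_pos[of "A - C" \<sigma> rest] fin by simp
  ultimately have "real (card (commuting A \<sigma> \<tau>)) powr - s
      \<le> real (k * card (commuting (A - C) \<sigma> rest)) powr - s"
    using assms by (intro powr_mono2') auto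
  then show ?thesis by (simp add: powr_mult)
qed

text \<open>By \<open>determined\<close>, a matching is encoded injectively by the walk through the
  component of \<open>x\<close> and by its restriction to the other points. Each term is bounded by
  \<open>commuting_powr_le\<close> in terms of its code, where \<open>l\<close> stands for
  \<open>k - 1\<close>, and the sum is then taken over all conceivable codes.\<close>

lemma commuting_sum_rec:
  assumes fin: "finite A" and \<sigma>: "fpf_invol_on \<sigma> A" and card: "card A = 2 * Suc n"
    and s: "0 \<le> s" and x: "x \<in> A"
  shows "commuting_sum s A \<sigma>
    \<le> (\<Sum>l\<le>n. \<Sum>ys\<in>edge_lists \<sigma> (A - {x, \<sigma> x}) l.
          real (Suc l) powr - s * commuting_sum s (A - covered \<sigma> (x # ys)) \<sigma>)"
proof -
  define tl where "tl \<tau> = two_matchings.tail A \<sigma> \<tau> x" for \<tau>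
  define rs where "rs \<tau> = two_matchings.rest A \<sigma> \<tau> x" for \<tau>
  define \<phi> where "\<phi> \<tau> = (length (tl \<tau>), tl \<tau>, rs \<tau>)" for \<tau>
  define g where "g = (\<lambda>(l, ys, \<tau>). real (Suc l) powr - s *
    real (card (commuting (A - covered \<sigma> (x # ys)) \<sigma> \<tau>)) powr - s)"
  define Y where "Y l = edge_lists \<sigma> (A - {x, \<sigma> x}) l" for l
  define T where "T = (SIGMA l:{..n}. SIGMA ys:Y l. matchings (A - covered \<sigma> (x # ys)))"
  have tm: "two_matchings A \<sigma> \<tau> x" if "\<tau> \<in> matchings A" for \<tau>
    using that fin \<sigma> x by (auto simp: two_matchings_def matchings_def)
  have finY: "finite (Y l)" for l
    unfolding Y_def using fin by (intro finite_edge_lists) auto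
  have finM: "finite (matchings (A - B))" for B
    using fin by (intro finite_matchings) auto
  have finT: "finite T"
    unfolding T_def by (intro finite_SigmaI finY finM) auto
  have in_T: "\<phi> \<tau> \<in> T" and le: "real (card (commuting A \<sigma> \<tau>)) powr - s \<le> g (\<phi> \<tau>)"
    if \<tau>: "\<tau> \<in> matchings A" for \<tau>
  proof -
    interpret two_matchings A \<sigma> \<tau> x using tm[OF \<tau>] .
    have len: "Suc (length tail) = k" using k_pos by (simp add: tail_def)
    have "x # tail \<in> edge_lists \<sigma> A (Suc (length tail))" using edge_list by (simp only: len)
    then have tY: "tail \<in> Y (length tail)" by (simp add: Cons_in_edge_lists Y_def)
    \<comment> \<open>The component has \<open>2 * k\<close> of the \<open>2 * Suc n\<close> points,
      whence \<open>k - 1 \<le> n\<close>.\<close>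
    have "2 * k = card C" using card_covered[OF fin \<sigma> edge_list] by (simp add: covered_eq)
    also have "\<dots> \<le> card A" using C_subset fin by (simp add: card_mono)
    finally have "length tail \<le> n" using card len by simp
    then show "\<phi> \<tau> \<in> T"
      using tY rest_matching by (simp add: \<phi>_def T_def tl_def rs_def covered_eq)
    show "real (card (commuting A \<sigma> \<tau>)) powr - s \<le> g (\<phi> \<tau>)"
      using commuting_powr_le[OF s] unfolding g_def \<phi>_def tl_def rs_def by (simp add: covered_eq flip: len)
  qed
  have inj: "inj_on \<phi> (matchings A)"
  proof (rule inj_onI)
    fix \<tau> \<tau>' assume *: "\<tau> \<in> matchings A" "\<tau>' \<in> matchings A" "\<phi> \<tau> = \<phi> \<tau>'"
    then show "\<tau> = \<tau>'"
      using two_matchings.determined[OF tm[OF *(2)] tm[OF *(1)]]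
      by (simp add: \<phi>_def tl_def rs_def matchings_def)
  qed
  have "commuting_sum s A \<sigma> \<le> (\<Sum>\<tau>\<in>matchings A. g (\<phi> \<tau>))"
    unfolding commuting_sum_def by (intro sum_mono le)
  also have "\<dots> = (\<Sum>z\<in>\<phi> ` matchings A. g z)"
    by (simp add: sum.reindex[OF inj])
  \<comment> \<open>All values of \<open>g\<close> are nonnegative, so enlarging the image of
    \<open>\<phi>\<close> to \<open>T\<close> can only increase the sum.\<close>
  also have "\<dots> \<le> (\<Sum>z\<in>T. g z)"
    using in_T finT by (intro sum_mono2) (auto simp: g_def)
  also have "\<dots> = (\<Sum>l\<le>n. \<Sum>z\<in>(SIGMA ys:Y l. matchings (A - covered \<sigma> (x # ys))). g (l, z))"
    unfolding T_def by (subst sum.Sigma) (auto simp: finY finM intro!: finite_SigmaI)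
  also have "\<dots> = (\<Sum>l\<le>n. \<Sum>ys\<in>Y l. \<Sum>\<tau>\<in>matchings (A - covered \<sigma> (x # ys)). g (l, ys, \<tau>))"
    by (intro sum.cong refl) (subst sum.Sigma, auto simp: finY finM)
  finally show ?thesis
    by (simp add: g_def commuting_sum_def sum_distrib_left Y_def)
qed

text \<open>Strong induction along the component of a point. The number of possible walks and the
  factor from the induction hypothesis multiply to \<open>2^n * n!\<close> whatever the size of the
  component, so the sum that remains is the one defining \<open>stick_seq\<close>.\<close>

lemma commuting_sum_le:
  assumes "finite A" "fpf_invol_on \<sigma> A" "card A = 2 * m" "0 \<le> s"
  shows "commuting_sum s A \<sigma> \<le> 2 ^ m * fact m * stick_seq (\<lambda>k. real k powr - s) m"
  using assms(1-3)
proof (induction m arbitrary: A rule: less_induct)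
  case (less m)
  show ?case
  proof (cases m)
    case 0
    then have "A = {}" using less.prems by simp
    moreover have "matchings {} = {id :: 'a \<Rightarrow> 'a}"
      by (auto simp: matchings_def fpf_invol_on_def)
    moreover have "commuting {} \<sigma> id = {id}"
      by (auto simp: commuting_def)
    ultimately show ?thesis by (simp add: commuting_sum_def 0)
  next
    case (Suc n)
    define u where "u = stick_seq (\<lambda>k. real k powr - s)"
    have "A \<noteq> {}" using less.prems Suc by auto
    then obtain x where x: "x \<in> A" by blast
    let ?E = "edge_lists \<sigma> (A - {x, \<sigma> x})"
    have IH: "commuting_sum s (A - covered \<sigma> (x # ys)) \<sigma> \<le> 2 ^ (n - l) * fact (n - l) * u (n - l)"
      if l: "l \<le> n" and ys: "ys \<in> ?E l" for l ys
    proof -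
      have e: "x # ys \<in> edge_lists \<sigma> A (Suc l)" using ys x by (simp add: Cons_in_edge_lists)
      have fin: "finite (covered \<sigma> (x # ys))" by (simp add: covered_def)
      show ?thesis unfolding u_def
      proof (rule less.IH)
        show "n - l < m" using Suc by simp
        show "finite (A - covered \<sigma> (x # ys))" using less.prems by simp
        show "fpf_invol_on \<sigma> (A - covered \<sigma> (x # ys))"
          using less.prems(2) covered_closed[OF less.prems(2) e] by (rule fpf_invol_on_Diff)
        show "card (A - covered \<sigma> (x # ys)) = 2 * (n - l)"
          using card_Diff_subset[OF fin covered_subset[OF less.prems(2) e]] card_covered[OF less.prems(1,2) e]
            less.prems(3) Suc l by simp
      qed
    qed
    \<comment> \<open>Apart from the edge of \<open>x\<close>, \<open>n\<close> edges of
      \<open>\<sigma>\<close> are available. In this product form the count absorbs the factor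
      \<open>fact (n - l)\<close> of the induction hypothesis.\<close>
    have card_E: "real (card (?E l)) * fact (n - l) = 2 ^ l * fact n" if "l \<le> n" for l
    proof -
      have "card (?E l) * fact (n - l) = 2 ^ l * fact n"
        using less.prems x Suc that
        by (intro card_edge_lists) (auto simp: fpf_invol_on_Diff_edge card_Diff_edge)
      then show ?thesis by (metis of_nat_fact of_nat_mult of_nat_numeral of_nat_power)
    qed
    have "commuting_sum s A \<sigma> \<le> (\<Sum>l\<le>n. \<Sum>ys\<in>?E l.
        real (Suc l) powr - s * commuting_sum s (A - covered \<sigma> (x # ys)) \<sigma>)"
      using less.prems assms(4) Suc x by (intro commuting_sum_rec) auto
    also have "\<dots> \<le> (\<Sum>l\<le>n. \<Sum>ys\<in>?E l.
        real (Suc l) powr - s * (2 ^ (n - l) * fact (n - l) * u (n - l)))"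
      by (intro sum_mono mult_left_mono IH) auto
    also have "\<dots> = (\<Sum>l\<le>n. 2 ^ n * fact n * (real (Suc l) powr - s * u (n - l)))"
    proof (intro sum.cong refl)
      fix l assume "l \<in> {..n}"
      then have l: "l \<le> n" by simp
      have "(\<Sum>ys\<in>?E l. real (Suc l) powr - s * (2 ^ (n - l) * fact (n - l) * u (n - l)))
          = (real (card (?E l)) * fact (n - l)) * 2 ^ (n - l) * (real (Suc l) powr - s * u (n - l))"
        by simp
      also have "\<dots> = (2 ^ l * 2 ^ (n - l)) * fact n * (real (Suc l) powr - s * u (n - l))"
        unfolding card_E[OF l] by simp
      also have "(2 :: real) ^ l * 2 ^ (n - l) = 2 ^ n" using l by (simp flip: power_add)
      finally show "(\<Sum>ys\<in>?E l. real (Suc l) powr - s * (2 ^ (n - l) * fact (n - l) * u (n - l)))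
          = 2 ^ n * fact n * (real (Suc l) powr - s * u (n - l))" .
    qed
    also have "\<dots> = 2 ^ n * fact n * (2 * real (Suc n) * u (Suc n))"
      by (simp add: sum_distrib_left[symmetric] u_def)
    also have "\<dots> = 2 ^ m * fact m * u m"
      unfolding Suc by (simp add: algebra_simps)
    finally show ?thesis by (simp add: u_def)
  qed
qed

section \<open>Conjugates of the hyperoctahedral group\<close>

text \<open>Take a list \<open>xs\<close> with one endpoint of every edge. A permutation commuting
  with \<open>\<sigma>\<close> is determined by its values on \<open>xs\<close>, and it sends
  \<open>xs\<close> to another list of this kind.\<close>

lemma card_commutant_le:
  assumes fin: "finite A" and \<sigma>: "fpf_invol_on \<sigma> A" and card: "card A = 2 * m"
  shows "card {p. p permutes A \<and> p \<circ> \<sigma> = \<sigma> \<circ> p} \<le> 2 ^ m * fact m"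
proof -
  have card_E: "card (edge_lists \<sigma> A m) = 2 ^ m * fact m"
    using card_edge_lists[OF fin \<sigma> card, of m] by simp
  then have "edge_lists \<sigma> A m \<noteq> {}" by (auto simp: fact_nonzero)
  then obtain xs where xs: "xs \<in> edge_lists \<sigma> A m" by auto
  have covered: "covered \<sigma> xs = A"
    using card_subset_eq[OF fin covered_subset[OF \<sigma> xs]] card_covered[OF fin \<sigma> xs] card by simp
  let ?H = "{p. p permutes A \<and> p \<circ> \<sigma> = \<sigma> \<circ> p}"
  have "inj_on (\<lambda>p. map p xs) ?H"
  proof (rule inj_onI)
    fix p q assume p: "p \<in> ?H" and q: "q \<in> ?H" and eq: "map p xs = map q xs"
    then have on_xs: "p z = q z" if "z \<in> set xs" for z using that by simp
    have comm: "p (\<sigma> z) = \<sigma> (p z)" "q (\<sigma> z) = \<sigma> (q z)" for z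
      using p q by (auto simp: fun_eq_iff)
    have "p z = q z" if "z \<in> A" for z
      using that on_xs comm unfolding covered[symmetric] by (auto simp: covered_def)
    moreover have "p z = q z" if "z \<notin> A" for z
      using that p q permutes_not_in by (metis (mono_tags, lifting) mem_Collect_eq)
    ultimately show "p = q" by blast
  qed
  moreover have "(\<lambda>p. map p xs) ` ?H \<subseteq> edge_lists \<sigma> A m"
  proof clarify
    fix p assume p: "p permutes A" "p \<circ> \<sigma> = \<sigma> \<circ> p"
    then have "\<sigma> (p z) = p (\<sigma> z)" for z by (metis o_apply)
    then show "map p xs \<in> edge_lists \<sigma> A m"
      using xs p by (auto simp: edge_lists_def sorted_wrt_map permutes_in_image
          inj_eq[OF permutes_inj[OF p(1)]])
  qed
  ultimately show ?thesis
    using card_inj_on_le[OF _ _ finite_edge_lists[OF fin]] card_E by metis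
qed

text \<open>If one conjugator \<open>h\<close> exists, composing with its inverse carries every
  other conjugator into the centralizer of \<open>\<sigma>\<close>: the conjugators form a
  coset.\<close>

lemma card_conjugators_le:
  assumes "finite A"
  shows "card {g. g permutes A \<and> g \<circ> \<sigma> \<circ> inv' g = \<tau>} \<le> card {p. p permutes A \<and> p \<circ> \<sigma> = \<sigma> \<circ> p}"
proof (cases "{g. g permutes A \<and> g \<circ> \<sigma> \<circ> inv' g = \<tau>} = {}")
  case True
  then show ?thesis by (simp only: card.empty)
next
  case False
  then obtain h where h: "h permutes A" "h \<circ> \<sigma> \<circ> inv' h = \<tau>" by auto
  have fin: "finite {p. p permutes A \<and> p \<circ> \<sigma> = \<sigma> \<circ> p}"
    by (rule finite_subset[OF _ finite_permutations[OF assms]]) auto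
  have hi: "inv' h (h z) = z" "h (inv' h z) = z" for z using permutes_inverses[OF h(1)] by auto
  show ?thesis
  proof (rule card_inj_on_le[OF _ _ fin])
    show "inj_on (\<lambda>g. inv' h \<circ> g) {g. g permutes A \<and> g \<circ> \<sigma> \<circ> inv' g = \<tau>}"
    proof (rule inj_onI)
      fix g g' assume "inv' h \<circ> g = inv' h \<circ> g'"
      then have "inv' h (g z) = inv' h (g' z)" for z by (simp add: fun_eq_iff)
      then show "g = g'" by (intro ext) (metis hi(2))
    qed
    show "(\<lambda>g. inv' h \<circ> g) ` {g. g permutes A \<and> g \<circ> \<sigma> \<circ> inv' g = \<tau>}
        \<subseteq> {p. p permutes A \<and> p \<circ> \<sigma> = \<sigma> \<circ> p}"
    proof clarify
      fix g assume g: "g permutes A" "\<tau> = g \<circ> \<sigma> \<circ> inv' g"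
      have "g (\<sigma> z) = h (\<sigma> (inv' h (g z)))" for z
        using fun_cong[OF h(2), of "g z"] g(2) permutes_inverses[OF g(1)] by simp
      then have "inv' h (g (\<sigma> z)) = \<sigma> (inv' h (g z))" for z by (simp add: hi)
      then show "inv' h \<circ> g permutes A \<and> inv' h \<circ> g \<circ> \<sigma> = \<sigma> \<circ> (inv' h \<circ> g)"
        using permutes_compose[OF g(1) permutes_inv[OF h(1)]] by (auto simp: fun_eq_iff)
    qed
  qed
qed

lemma conj_in_matchings:
  assumes "\<sigma> \<in> matchings A" "g permutes A"
  shows "g \<circ> \<sigma> \<circ> inv' g \<in> matchings A"
proof -
  have \<sigma>: "\<sigma> permutes A" "fpf_invol_on \<sigma> A" using assms by (auto simp: matchings_def)
  have gi: "inv' g (g z) = z" "g (inv' g z) = z" for z using permutes_inverses[OF assms(2)] by auto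
  have inA: "inv' g z \<in> A \<longleftrightarrow> z \<in> A" "g z \<in> A \<longleftrightarrow> z \<in> A" for z
    using permutes_in_image[OF assms(2)] permutes_in_image[OF permutes_inv[OF assms(2)]] by auto
  have "fpf_invol_on (g \<circ> \<sigma> \<circ> inv' g) A"
    using fpf_invol_onD[OF \<sigma>(2)] unfolding fpf_invol_on_def by (auto simp: gi inA) (metis gi(1) inA(1))
  then show ?thesis
    using \<sigma>(1) assms(2) by (auto simp: matchings_def intro!: permutes_compose permutes_inv)
qed

text \<open>One factor \<open>2^m * m!\<close> comes from the sum over matchings via Markov's
  inequality, the other from the number of \<open>g\<close> that conjugate \<open>\<sigma>\<close>
  to a given matching.\<close>

lemma card_rare_conjugators_le:
  assumes fin: "finite A" and \<sigma>: "\<sigma> \<in> matchings A" and card: "card A = 2 * m" and s: "0 \<le> s" and B: "0 < B"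
  shows "real (card {g. g permutes A \<and> real (card (commuting A \<sigma> (g \<circ> \<sigma> \<circ> inv' g))) < B})
    \<le> (2 ^ m * fact m)\<^sup>2 * (B powr s * stick_seq (\<lambda>k. real k powr - s) m)"
proof -
  have inv: "fpf_invol_on \<sigma> A" using \<sigma> by (simp add: matchings_def)
  define R where "R = {\<tau> \<in> matchings A. real (card (commuting A \<sigma> \<tau>)) < B}"
  have finR: "finite R" unfolding R_def using finite_matchings[OF fin] by simp
  have "real (card R) \<le> (\<Sum>\<tau>\<in>R. B powr s * real (card (commuting A \<sigma> \<tau>)) powr - s)"
  proof -
    \<comment> \<open>Markov's inequality for the negative moment: on \<open>R\<close> each summand
      is at least \<open>1\<close>.\<close>
    have "1 \<le> B powr s * real (card (commuting A \<sigma> \<tau>)) powr - s" if "\<tau> \<in> R" for \<tau>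
    proof -
      have "1 = B powr s * B powr - s" using B by (simp flip: powr_add)
      also have "\<dots> \<le> B powr s * real (card (commuting A \<sigma> \<tau>)) powr - s"
        using that card_commuting_pos[OF fin, of \<sigma> \<tau>] s
        by (intro mult_left_mono powr_mono2') (auto simp: R_def)
      finally show ?thesis .
    qed
    from sum_mono[of R "\<lambda>_. 1", OF this] show ?thesis by simp
  qed
  also have "\<dots> \<le> (\<Sum>\<tau>\<in>matchings A. B powr s * real (card (commuting A \<sigma> \<tau>)) powr - s)"
    using finite_matchings[OF fin] by (intro sum_mono2) (auto simp: R_def)
  also have "\<dots> = B powr s * commuting_sum s A \<sigma>"
    by (simp add: commuting_sum_def sum_distrib_left)
  also have "\<dots> \<le> B powr s * (2 ^ m * fact m * stick_seq (\<lambda>k. real k powr - s) m)"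
    by (intro mult_left_mono commuting_sum_le fin inv card s) simp
  finally have card_R: "real (card R) \<le> B powr s * (2 ^ m * fact m * stick_seq (\<lambda>k. real k powr - s) m)" .
  have "card {g. g permutes A \<and> real (card (commuting A \<sigma> (g \<circ> \<sigma> \<circ> inv' g))) < B}
      \<le> card (\<Union>\<tau>\<in>R. {g. g permutes A \<and> g \<circ> \<sigma> \<circ> inv' g = \<tau>})"
    using finR by (intro card_mono finite_UN_I finite_subset[OF _ finite_permutations[OF fin]])
      (auto simp: R_def conj_in_matchings[OF \<sigma>])
  also have "\<dots> \<le> (\<Sum>\<tau>\<in>R. card {g. g permutes A \<and> g \<circ> \<sigma> \<circ> inv' g = \<tau>})"
    by (rule card_UN_le[OF finR])
  also have "\<dots> \<le> (\<Sum>\<tau>\<in>R. 2 ^ m * fact m)"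
    by (intro sum_mono order.trans[OF card_conjugators_le[OF fin] card_commutant_le[OF fin inv card]])
  finally have "real (card {g. g permutes A \<and> real (card (commuting A \<sigma> (g \<circ> \<sigma> \<circ> inv' g))) < B})
      \<le> real (card R * (2 ^ m * fact m))"
    by (simp only: sum_constant of_nat_le_iff of_nat_id)
  also have "\<dots> = 2 ^ m * fact m * real (card R)" by simp
  also have "\<dots> \<le> 2 ^ m * fact m * (B powr s * (2 ^ m * fact m * stick_seq (\<lambda>k. real k powr - s) m))"
    by (intro mult_left_mono card_R) simp
  also have "\<dots> = (2 ^ m * fact m)\<^sup>2 * (B powr s * stick_seq (\<lambda>k. real k powr - s) m)"
    by (simp only: power2_eq_square mult_ac)
  finally show ?thesis .
qed

section \<open>The standard pairing and the intersection of its centralizer with a conjugate\<close>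

lemma pairing_apply:
  "pairing m x = (if x \<in> {1..2 * m} then if odd x then Suc x else x - 1 else x)"
proof (induction m arbitrary: x)
  case (Suc m)
  consider "x = 2 * m + 1" | "x = 2 * m + 2" | "x \<noteq> 2 * m + 1" "x \<noteq> 2 * m + 2" by blast
  then show ?case
    by cases (auto simp: Suc.IH transpose_apply_other)
qed simp

lemma pairing_in_matchings: "pairing m \<in> matchings {1..2 * m}"
proof -
  have inv: "fpf_invol_on (pairing m) {1..2 * m}"
    unfolding fpf_invol_on_def
  proof
    fix x assume x: "x \<in> {1..2 * m}"
    show "pairing m x \<in> {1..2 * m} \<and> pairing m x \<noteq> x \<and> pairing m (pairing m x) = x"
    proof (cases "odd x")
      case True
      then have "Suc x \<in> {1..2 * m}" using x by simp presburger
      then show ?thesis using True x by (simp add: pairing_apply)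
    next
      case False
      then have "x - 1 \<in> {1..2 * m}" "odd (x - 1)" using x by (auto elim!: evenE)
      then show ?thesis using False x by (simp add: pairing_apply)
    qed
  qed
  then have "bij_betw (pairing m) {1..2 * m} {1..2 * m}"
    by (intro bij_betwI[of _ _ _ "pairing m"]) (use fpf_invol_onD[OF inv] in auto)
  then have "pairing m permutes {1..2 * m}"
    by (rule bij_imp_permutes) (simp only: pairing_apply if_False)
  with inv show ?thesis by (simp add: matchings_def)
qed

text \<open>If \<open>p\<close> commutes with the conjugate of the pairing by \<open>g\<close>, then
  conjugating \<open>p\<close> back by \<open>g\<close> gives an element commuting with the pairing
  itself, so \<open>p\<close> lies in the conjugate of \<open>H_sub m\<close>.\<close>

lemma commuting_le_inter_order:
  assumes g: "g permutes {1..2 * m}"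
  shows "card (commuting {1..2 * m} (pairing m) (g \<circ> pairing m \<circ> inv' g)) \<le> inter_order m g"
proof -
  let ?A = "{1..2 * m}" and ?t = "pairing m"
  let ?t' = "g \<circ> ?t \<circ> inv' g"
  have gi: "inv' g (g z) = z" "g (inv' g z) = z" for z using permutes_inverses[OF g] by auto
  have gig: "inv' g permutes ?A" using g by (rule permutes_inv)
  have fixed: "\<tau> z = z" if "\<tau> \<in> matchings ?A" "z \<notin> ?A" for \<tau> z
    using that permutes_not_in[of \<tau> ?A z] by (auto simp: matchings_def)
  have H: "H_sub m = {p. p permutes ?A \<and> p \<circ> ?t = ?t \<circ> p}"
    by (auto simp: H_sub_def centralizer_def sym_group_def)
  have K: "conj_subset (sym_group (2 * m)) g (H_sub m) = (\<lambda>h. g \<circ> h \<circ> inv' g) ` H_sub m"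
    using g by (auto simp: conj_subset_def l_coset_def r_coset_def sym_group_carrier sym_group_mult)
  have "commuting ?A ?t ?t' \<subseteq> H_sub m \<inter> conj_subset (sym_group (2 * m)) g (H_sub m)"
  proof
    fix p assume p: "p \<in> commuting ?A ?t ?t'"
    then have perm: "p permutes ?A" by (simp add: commuting_def)
    \<comment> \<open>Commutation is known on \<open>?A\<close> only; it extends to all points since
      \<open>p\<close> and both matchings fix everything outside.\<close>
    have all: "p (\<tau> z) = \<tau> (p z)" if "\<tau> = ?t \<or> \<tau> = ?t'" for \<tau> z
    proof (cases "z \<in> ?A")
      case True
      then show ?thesis using p that by (auto simp: commuting_def)
    next
      case False
      moreover have "\<tau> \<in> matchings ?A"
        using that pairing_in_matchings conj_in_matchings[OF pairing_in_matchings g] by auto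
      ultimately have "\<tau> z = z" by (intro fixed)
      then show ?thesis using permutes_not_in[OF perm False] by simp
    qed
    have "p \<in> H_sub m" using perm all[of ?t] by (auto simp: H)
    moreover have "inv' g \<circ> p \<circ> g \<in> H_sub m"
    proof -
      have "inv' g (p (g (?t z))) = ?t (inv' g (p (g z)))" for z
        using all[of ?t' "g z"] by (simp add: gi)
      then show ?thesis
        using perm g gig by (auto simp: H fun_eq_iff intro!: permutes_compose)
    qed
    moreover have "p = g \<circ> (inv' g \<circ> p \<circ> g) \<circ> inv' g" by (simp add: fun_eq_iff gi)
    ultimately show "p \<in> H_sub m \<inter> conj_subset (sym_group (2 * m)) g (H_sub m)"
      unfolding K by blast
  qed
  moreover have "finite (H_sub m)"
    unfolding H by (rule finite_subset[OF _ finite_permutations[of ?A]]) auto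
  ultimately show ?thesis unfolding inter_order_def by (intro card_mono) auto
qed

section \<open>Asymptotics and density\<close>

lemma density_small_inter_order:
  assumes c: "0 < c"
  shows "(\<lambda>m. real (card {g \<in> carrier (sym_group (2 * m)). real (inter_order m g) < real m powr c})
    / fact (2 * m)) \<longlonglongrightarrow> 0"
proof -
  \<comment> \<open>With this \<open>s\<close> and \<open>\<delta> = 1/8\<close>, the exponents of
    \<open>m\<close> add up to \<open>1/2 + 1/8 + (1/8 - 1) = -1/4\<close>.\<close>
  define s where "s = 1 / (8 * c)"
  define u where "u = stick_seq (\<lambda>k. real k powr - s)"
  have s: "0 < s" "c * s = 1 / 8" using c by (auto simp: s_def)
  \<comment> \<open>At \<open>k = 0\<close> this relies on the convention that
    \<open>0 powr - s\<close> is \<open>0\<close>.\<close>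
  have "real k powr - s \<le> 1" for k
    using powr_mono[of "- s" 0 "real k"] s by (cases "k = 0") auto
  moreover have "(\<lambda>k. real k powr - s) \<longlonglongrightarrow> 0"
    using s by (intro tendsto_neg_powr filterlim_real_sequentially) auto
  ultimately obtain D where D: "\<forall>\<^sub>F m in sequentially. u m \<le> D * real m powr (1 / 8 - 1)"
    unfolding u_def using stick_seq_bound[of "\<lambda>k. real k powr - s" "1 / 8"] by auto
  have bound: "real (card {g \<in> carrier (sym_group (2 * m)). real (inter_order m g) < real m powr c})
      / fact (2 * m) \<le> 2 * D * real m powr (- 1 / 4)"
    if m: "m > 0" and um: "u m \<le> D * real m powr (1 / 8 - 1)" for m
  proof -
    let ?A = "{1..2 * m}"
    let ?R = "{g. g permutes ?A \<and>
      real (card (commuting ?A (pairing m) (g \<circ> pairing m \<circ> inv' g))) < real m powr c}"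
    have u0: "0 \<le> u m" unfolding u_def by (rule stick_seq_nonneg) simp
    have "{g \<in> carrier (sym_group (2 * m)). real (inter_order m g) < real m powr c} \<subseteq> ?R"
      using commuting_le_inter_order[of _ m] by (force simp: sym_group_carrier)
    then have "real (card {g \<in> carrier (sym_group (2 * m)). real (inter_order m g) < real m powr c})
        \<le> real (card ?R)"
      by (intro of_nat_mono card_mono finite_subset[OF _ finite_permutations[of ?A]]) auto
    also have "\<dots> \<le> (2 ^ m * fact m)\<^sup>2 * ((real m powr c) powr s * u m)"
      unfolding u_def using m s pairing_in_matchings by (intro card_rare_conjugators_le) auto
    also have "\<dots> \<le> (2 * sqrt (real m) * fact (2 * m)) * ((real m powr c) powr s * u m)"
      using fact_double_le[OF m] u0 by (intro mult_right_mono) auto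
    also have "\<dots> \<le> (2 * sqrt (real m) * fact (2 * m)) *
        (real m powr (1 / 8) * (D * real m powr (1 / 8 - 1)))"
      unfolding powr_powr s(2) by (intro mult_left_mono um) auto
    also have "\<dots> = 2 * D * (real m powr (1 / 2) * real m powr (1 / 8) * real m powr (1 / 8 - 1)) * fact (2 * m)"
      using m by (simp add: powr_half_sqrt)
    also have "real m powr (1 / 2) * real m powr (1 / 8) * real m powr (1 / 8 - 1) = real m powr (- 1 / 4)"
      by (simp flip: powr_add)
    finally show ?thesis by (simp add: pos_divide_le_eq)
  qed
  have upper: "\<forall>\<^sub>F m in sequentially.
      real (card {g \<in> carrier (sym_group (2 * m)). real (inter_order m g) < real m powr c})
      / fact (2 * m) \<le> 2 * D * real m powr (- 1 / 4)"
    using D eventually_gt_at_top[of 0] by eventually_elim (rule bound)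
  have "(\<lambda>m. 2 * D * real m powr (- 1 / 4)) \<longlonglongrightarrow> 0"
    by (intro tendsto_mult_right_zero tendsto_neg_powr filterlim_real_sequentially) auto
  then show ?thesis
    by (rule tendsto_sandwich[OF _ upper tendsto_const, rotated]) simp
qed

text \<open>A bounded exponent is eventually at most some constant \<open>C\<close>, so
  \<open>A m\<close> eventually lies in the set of elements with intersection order below
  \<open>m powr (C + 1)\<close>. The extra \<open>1\<close> makes the inequality strict for
  \<open>m > 1\<close>.\<close>

lemma density_zero_good_family:
  assumes "good_family A"
  shows "density_zero A"
proof -
  from assms obtain e :: "nat \<Rightarrow> real" where sub: "\<And>m. A m \<subseteq> carrier (sym_group (2 * m))"
    and e: "e \<in> O(\<lambda>_. 1)"
    and good: "\<forall>\<^sub>F m in sequentially. \<forall>g\<in>A m. real (inter_order m g) \<le> real m powr e m"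
    by (auto simp: good_family_def)
  obtain C where C: "C > 0" "\<forall>\<^sub>F m in sequentially. \<bar>e m\<bar> \<le> C"
    using e by (auto elim: landau_o.bigE)
  let ?S = "\<lambda>m. {g \<in> carrier (sym_group (2 * m)). real (inter_order m g) < real m powr (C + 1)}"
  have upper: "\<forall>\<^sub>F m in sequentially. real (card (A m)) / fact (2 * m) \<le> real (card (?S m)) / fact (2 * m)"
    using good C(2) eventually_gt_at_top[of 1]
  proof eventually_elim
    case (elim m)
    have "real m powr e m < real m powr (C + 1)"
      using elim(2,3) by (intro powr_less_mono) auto
    then have "A m \<subseteq> ?S m" using sub elim(1) by fastforce
    moreover have "finite (?S m)"
      by (rule finite_subset[OF _ finite_permutations[of "{1..2 * m}"]]) (auto simp: sym_group_carrier)
    ultimately show ?case by (intro divide_right_mono of_nat_mono card_mono) auto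
  qed
  have "0 < C + 1" using C(1) by simp
  from density_small_inter_order[OF this] show ?thesis
    unfolding density_zero_def by (rule tendsto_sandwich[OF _ upper tendsto_const, rotated]) simp
qed

theorem theorem0p2:
  shows "(\<forall>c::real. c > 0 \<longrightarrow>
           (\<lambda>m::nat. real (card {g \<in> carrier (sym_group (2 * m)). real (inter_order m g) < real m powr c})
                      / fact (2 * m)) \<longlonglongrightarrow> 0)
       \<and> (\<forall>A. good_family A \<longrightarrow> density_zero A)"
  by (intro conjI allI impI density_small_inter_order density_zero_good_family)

end
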